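(* Let $X$ be a non-empty compact doubling metric space. Then $$\dim_p(X) = \min\{\dim_\Theta(\mu) : \mu\text{ is a fully supported finite Borel measure on }X\},$$ where $\dim_p$ is packing dimension and $\dim_\Theta$ is the density dimension; in particular the minimum is attained.
   Context: $B(x,r)$ is the closed ball of centre $x$ and radius $r$. A metric space $X$ is doubling if there is $N\in\mathbb{N}$ such that any closed ball of radius $r>0$ can be covered by $N$ balls of radius $r/2$. A Borel measure on $X$ is fully supported if its support is $X$. The lower $s$-density of $\mu$ at $x\in X$ is $$\Theta^s_*(\mu,x)=\liminf_{r\downarrow 0}\frac{\mu(B(x,r))}{(2r)^s},$$ and the density dimension of $\mu$ is $$\dim_\Theta(\mu)=\inf\{s\ge 0 : \Theta^s_*(\mu,x)>0\text{ for all }x\in X\}$$ (with $\inf\emptyset=\infty$). $\dim_p$ is the usual packing dimension of a set (the critical exponent of the packing measures $\mathcal{P}^s$); equivalently, $\dim_p(A)=\inf\{\sup_{i}\overline{\dim}_M(A_i) : A\subset\bigcup_{i\in\mathbb{N}}A_i\}$, where $\overline{\dim}_M(E)=\limsup_{r\downarrow 0}\log N_r(E)/(-\log r)$ and $N_r(E)$ is the maximal number of pairwise disjoint closed balls of radius $r$ in $E$ (with the restricted metric). *)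

theory Defs
  imports "HOL-Analysis.Analysis"
begin

text \<open>The metric space carrying a measure is a whole type of class \<open>metric_space\<close>; for a set \<open>A\<close>,
  packings of \<open>A\<close> use balls of that ambient space centred in \<open>A\<close>.\<close>

definition doubling :: "'a::metric_space set \<Rightarrow> bool" where
  "doubling X \<longleftrightarrow>
     (\<exists>N::nat. \<forall>x\<in>X. \<forall>r>0. \<exists>C\<subseteq>X. finite C \<and> card C \<le> N \<and>
        X \<inter> cball x r \<subseteq> (\<Union>c\<in>C. cball c (r / 2)))"

definition measure_support :: "'a::topological_space measure \<Rightarrow> 'a set" where
  "measure_support M = {x. \<forall>U. open U \<longrightarrow> x \<in> U \<longrightarrow> emeasure M U > 0}"

definition lower_density :: "real \<Rightarrow> 'a::metric_space measure \<Rightarrow> 'a \<Rightarrow> ennreal" where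
  "lower_density s M x =
     Liminf (at_right 0) (\<lambda>r. emeasure M (cball x r) / ennreal ((2 * r) powr s))"

text \<open>In \<open>ennreal\<close> the infimum of the empty set is \<open>\<infinity>\<close>.\<close>

definition density_dim :: "'a::metric_space measure \<Rightarrow> ennreal" where
  "density_dim M = Inf (ennreal ` {s. s \<ge> 0 \<and> (\<forall>x. lower_density s M x > 0)})"

text \<open>
  A ball is recorded as a pair of its centre and its radius, because in a metric space these are
  not determined by the ball as a set; accordingly the premeasure below weighs a ball by
  \<open>(2 * r) powr s\<close> with \<open>r\<close> its given radius, not by its diameter.
\<close>

definition packings :: "real \<Rightarrow> 'a::metric_space set \<Rightarrow> ('a \<times> real) set set" where
  "packings \<delta> A =
     {P. countable P \<and> P \<subseteq> A \<times> {0<..\<delta>} \<and>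
         pairwise (\<lambda>(x, r) (y, t). disjnt (cball x r) (cball y t)) P}"

text \<open>The supremum is monotone in \<open>\<delta>\<close>, so the infimum is its limit as \<open>\<delta>\<close> tends to \<open>0\<close>.\<close>

definition packing_premeasure :: "real \<Rightarrow> 'a::metric_space set \<Rightarrow> ennreal" where
  "packing_premeasure s A =
     (INF \<delta>\<in>{0<..}. SUP P\<in>packings \<delta> A. \<Sum>\<^sub>\<infinity>(x, r)\<in>P. ennreal ((2 * r) powr s))"

definition packing_measure :: "real \<Rightarrow> 'a::metric_space set \<Rightarrow> ennreal" where
  "packing_measure s A =
     (INF E\<in>{E :: nat \<Rightarrow> 'a set. A \<subseteq> (\<Union>i. E i)}. \<Sum>i. packing_premeasure s (E i))"

definition packing_dim :: "'a::metric_space set \<Rightarrow> ennreal" where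
  "packing_dim A = Inf (ennreal ` {s. s \<ge> 0 \<and> packing_measure s A = 0})"

definition fully_supported_finite_borel :: "'a::metric_space measure \<Rightarrow> bool" where
  "fully_supported_finite_borel M \<longleftrightarrow>
     sets M = sets borel \<and> finite_measure M \<and> measure_support M = UNIV"

end

theory Submission
  imports Defs
begin

text \<open>Write \<open>d\<close> for the packing dimension of the whole space.

  \<^emph>\<open>No measure does better than \<open>d\<close>.\<close> If the lower \<open>s\<close>-density of a finite measure \<open>M\<close> is
  positive everywhere, then the space is a countable union of sets \<open>E n\<close> on each of which all small
  balls satisfy \<open>M (cball x r) \<ge> const * (2 * r) powr s\<close> with one constant. A packing of \<open>E n\<close> consists
  of disjoint balls, so the sum of \<open>(2 * r) powr s\<close> over it is bounded by a multiple of the total mass;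
  for \<open>t > s\<close> and radii at most \<open>\<delta>\<close> this makes the sum of \<open>(2 * r) powr t\<close> at most a multiple of
  \<open>(2 * \<delta>) powr (t - s)\<close>, which tends to \<open>0\<close>
  (\<open>packing_premeasure_eq_0_of_ball_mass\<close>, \<open>packing_dim_le_density_dim\<close>).

  \<^emph>\<open>Some measure attains \<open>d\<close>.\<close> Let \<open>E\<close> have finite \<open>s\<close>-dimensional packing premeasure and let
  \<open>t > s\<close>. Using packings with equal radii, a \<open>q\<close>-separated subset of \<open>E\<close> has at most
  \<open>C * q powr (- s)\<close> points when \<open>q\<close> is small, so \<open>E\<close> has a finite \<open>q\<close>-net of this size. Put an atom
  of mass \<open>q powr t\<close> on every point of such a net, for every scale \<open>q\<close> in a geometric sequence. The
  total mass is at most a convergent geometric series of ratio \<open>(1/2) powr (t - s)\<close>, while a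
  ball of radius \<open>r\<close> centred in \<open>E\<close> contains a net point of some scale \<open>q\<close> comparable to \<open>r\<close>, hence has
  mass at least a multiple of \<open>r powr t\<close> (\<open>packing_premeasure_finite_imp_point_masses\<close>).
  For exponents \<open>s\<close> converging to \<open>d\<close> with \<open>packing_measure s UNIV = 0\<close>, the space is a
  countable union of sets of finite \<open>s\<close>-premeasure; a weighted sum of all the resulting atomic measures
  is finite and has positive lower \<open>t\<close>-density everywhere, for exponents \<open>t\<close> arbitrarily close to \<open>d\<close>
  (\<open>exists_density_dim_le_packing_dim\<close>). Positive density everywhere also gives full support.
  If \<open>d\<close> is infinite, then by the first part any fully supported finite measure attains it, and
  compactness supplies one: put atoms on finite nets.\<close>

section \<open>Packing dimension as a lower bound for density dimension\<close>

text \<open>For \<open>r \<le> \<delta>\<close> one has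
  \<open>(2 * r) powr t \<le> (2 * \<delta>) powr (t - s) * (2 * r) powr s\<close>, and the second factor is controlled by the mass
  of the ball. Disjointness of the packing bounds the sum of these masses by the total mass, uniformly
  in the packing, and the factor \<open>(2 * \<delta>) powr (t - s)\<close> vanishes in the limit.\<close>

lemma packing_premeasure_eq_0_of_ball_mass:
  fixes M :: "'a::metric_space measure"
  assumes M: "sets M = sets borel" "finite_measure M"
    and st: "s < t" and c: "0 < c" and \<rho>: "0 < \<rho>"
    and E: "\<And>x r. x \<in> E \<Longrightarrow> 0 < r \<Longrightarrow> r \<le> \<rho> \<Longrightarrow> ennreal (c * (2 * r) powr s) \<le> emeasure M (cball x r)"
  shows "packing_premeasure t E = 0"
proof -
  interpret finite_measure M by fact
  define K where "K = measure M (space M) / c"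
  have K: "0 \<le> K" using c by (simp add: K_def)
  have packing_sum_le: "(\<Sum>\<^sub>\<infinity>(x, r)\<in>P. ennreal ((2 * r) powr t)) \<le> ennreal ((2 * \<delta>) powr (t - s) * K)"
    if \<delta>: "0 < \<delta>" "\<delta> \<le> \<rho>" and P: "P \<in> packings \<delta> E" for P \<delta>
  proof -
    have "(\<Sum>(x, r)\<in>F. ennreal ((2 * r) powr t)) \<le> ennreal ((2 * \<delta>) powr (t - s) * K)"
      if F: "finite F" "F \<subseteq> P" for F
    proof -
      have PE: "x \<in> E \<and> 0 < r \<and> r \<le> \<delta>" if "(x, r) \<in> F" for x r
        using P F that by (auto simp: packings_def)
      have disj: "disjoint_family_on (\<lambda>(x, r). cball x r) F"
      proof -
        have "pairwise (\<lambda>(x, r) (y, t). disjnt (cball x r) (cball y t)) F"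
          using P F pairwise_subset unfolding packings_def by blast
        then show ?thesis
          by (simp add: pairwise_def disjoint_family_on_def disjnt_def case_prod_unfold)
      qed
      have meas: "(\<lambda>(x, r). cball x r) ` F \<subseteq> sets M"
        unfolding M(1) by (intro image_subsetI) (simp add: case_prod_unfold)
      have ball: "c * (2 * r) powr s \<le> measure M (cball x r)" if "(x, r) \<in> F" for x r
        using E[of x r] PE[OF that] \<delta> by (simp add: emeasure_eq_measure)
      have "(\<Sum>(x, r)\<in>F. (2 * r) powr t) \<le> (\<Sum>(x, r)\<in>F. (2 * \<delta>) powr (t - s) * (measure M (cball x r) / c))"
      proof (rule sum_mono, clarify)
        fix x r assume xr: "(x, r) \<in> F"
        have "(2 * r) powr t = (2 * r) powr (t - s) * (2 * r) powr s"
          by (simp flip: powr_add)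
        also have "\<dots> \<le> (2 * \<delta>) powr (t - s) * (measure M (cball x r) / c)"
          using PE[OF xr] ball[OF xr] st c
          by (intro mult_mono powr_mono2) (auto simp: field_simps)
        finally show "(2 * r) powr t \<le> (2 * \<delta>) powr (t - s) * (measure M (cball x r) / c)" .
      qed
      also have "\<dots> = (2 * \<delta>) powr (t - s) * ((\<Sum>p\<in>F. measure M (case p of (x, r) \<Rightarrow> cball x r)) / c)"
        by (simp add: sum_distrib_left sum_divide_distrib case_prod_unfold)
      also have "(\<Sum>p\<in>F. measure M (case p of (x, r) \<Rightarrow> cball x r)) = measure M (\<Union>p\<in>F. case p of (x, r) \<Rightarrow> cball x r)"
        using finite_measure_finite_Union[OF F(1) meas disj] by simp
      also have "(2 * \<delta>) powr (t - s) * (\<dots> / c) \<le> (2 * \<delta>) powr (t - s) * K"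
        unfolding K_def using c by (intro mult_left_mono divide_right_mono bounded_measure) auto
      finally have "(\<Sum>(x, r)\<in>F. (2 * r) powr t) \<le> (2 * \<delta>) powr (t - s) * K" .
      moreover have "(\<Sum>(x, r)\<in>F. ennreal ((2 * r) powr t)) = ennreal (\<Sum>(x, r)\<in>F. (2 * r) powr t)"
        by (simp add: case_prod_unfold)
      ultimately show ?thesis by (simp add: ennreal_leI)
    qed
    then show ?thesis
      by (subst nonneg_infsum_complete) (auto intro: SUP_least)
  qed
  have bound: "packing_premeasure t E \<le> ennreal ((2 * \<delta>) powr (t - s) * K)"
    if "0 < \<delta>" "\<delta> \<le> \<rho>" for \<delta>
    unfolding packing_premeasure_def
    using that packing_sum_le by (intro INF_lower2[of \<delta>] SUP_least) auto
  have "((\<lambda>\<delta>. ennreal ((2 * \<delta>) powr (t - s) * K)) \<longlongrightarrow> ennreal (0 * K)) (at_right 0)"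
  proof (intro tendsto_ennrealI tendsto_mult tendsto_const)
    have "((\<lambda>\<delta>::real. (2 * \<delta>) powr (t - s)) \<longlongrightarrow> (2 * 0) powr (t - s)) (at_right 0)"
      using st by (intro tendsto_powr' tendsto_intros)
        (auto simp: eventually_at_right_less intro!: eventually_at_rightI[of 0 1])
    then show "((\<lambda>\<delta>::real. (2 * \<delta>) powr (t - s)) \<longlongrightarrow> 0) (at_right 0)" by simp
  qed
  moreover have "eventually (\<lambda>\<delta>. packing_premeasure t E \<le> ennreal ((2 * \<delta>) powr (t - s) * K)) (at_right 0)"
    using \<rho> bound by (intro eventually_at_rightI[of 0 \<rho>]) auto
  ultimately have "packing_premeasure t E \<le> ennreal (0 * K)"
    by (intro tendsto_lowerbound) auto
  then show ?thesis by simp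
qed

text \<open>Both the constant and the range of radii are expressed through the same natural
  number, so that the points satisfying the bound for a given \<open>n\<close> form a countable cover.\<close>

lemma lower_density_pos_imp_mass_bound:
  assumes "0 < lower_density s M x"
  obtains n where "\<And>r. 0 < r \<Longrightarrow> r \<le> inverse (real (Suc n)) \<Longrightarrow>
      ennreal (inverse (real (Suc n)) * (2 * r) powr s) \<le> emeasure M (cball x r)"
proof -
  obtain y where y: "0 < y" "y < lower_density s M x"
    using assms dense by blast
  then have "y < \<infinity>" by (metis infinity_ennreal_def less_top_ennreal order.strict_trans2 top_greatest)
  then obtain c where c: "y = ennreal c" "0 < c"
    using y(1) by (cases y) auto
  have "eventually (\<lambda>r. y < emeasure M (cball x r) / ennreal ((2 * r) powr s)) (at_right 0)"
    using y(2) unfolding lower_density_def by (rule less_LiminfD)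
  then obtain b where b: "0 < b" "\<And>r. 0 < r \<Longrightarrow> r < b \<Longrightarrow> y < emeasure M (cball x r) / ennreal ((2 * r) powr s)"
    unfolding eventually_at_right_field by auto
  obtain n where n: "inverse (real (Suc n)) < min b c"
    using reals_Archimedean[of "min b c"] b(1) c(2) by auto
  show ?thesis
  proof (rule that[of n])
    fix r :: real assume r: "0 < r" "r \<le> inverse (real (Suc n))"
    have p: "0 < (2 * r) powr s" using r by simp
    have "ennreal (inverse (real (Suc n)) * (2 * r) powr s) \<le> ennreal (c * (2 * r) powr s)"
      using n p by (intro ennreal_leI mult_right_mono) auto
    also have "\<dots> = y * ennreal ((2 * r) powr s)"
      using c by (simp add: ennreal_mult')
    also have "\<dots> \<le> emeasure M (cball x r) / ennreal ((2 * r) powr s) * ennreal ((2 * r) powr s)"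
      using b(2)[of r] r n by (intro mult_right_mono) auto
    also have "\<dots> = emeasure M (cball x r)"
      using p by (simp add: ennreal_divide_times flip: ennreal_times_divide)
    finally show "ennreal (inverse (real (Suc n)) * (2 * r) powr s) \<le> emeasure M (cball x r)" .
  qed
qed

lemma packing_dim_le_density_dim:
  fixes M :: "'a::metric_space measure"
  assumes M: "sets M = sets borel" "finite_measure M"
  shows "packing_dim (UNIV :: 'a set) \<le> density_dim M"
  unfolding density_dim_def
proof (rule Inf_greatest, clarify)
  fix s :: real assume s: "0 \<le> s" "\<forall>x. 0 < lower_density s M x"
  have "packing_measure t (UNIV :: 'a set) = 0" if t: "s < t" for t
  proof -
    define E where "E n = {x. \<forall>r. 0 < r \<longrightarrow> r \<le> inverse (real (Suc n)) \<longrightarrow>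
      ennreal (inverse (real (Suc n)) * (2 * r) powr s) \<le> emeasure M (cball x r)}" for n
    have "\<exists>n. x \<in> E n" for x
    proof -
      from s(2) have "0 < lower_density s M x" by simp
      then obtain n where "\<And>r. 0 < r \<Longrightarrow> r \<le> inverse (real (Suc n)) \<Longrightarrow>
          ennreal (inverse (real (Suc n)) * (2 * r) powr s) \<le> emeasure M (cball x r)"
        using lower_density_pos_imp_mass_bound[of s M x] by metis
      then have "x \<in> E n" unfolding E_def by simp
      then show ?thesis ..
    qed
    then have cover: "UNIV \<subseteq> (\<Union>n. E n)" by auto
    have "packing_premeasure t (E n) = 0" for n
      by (rule packing_premeasure_eq_0_of_ball_mass[OF M t,
            of "inverse (real (Suc n))" "inverse (real (Suc n))"]) (auto simp: E_def)
    then have "packing_measure t (UNIV :: 'a set) \<le> 0"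
      unfolding packing_measure_def using cover by (intro INF_lower2[of E]) auto
    then show ?thesis by simp
  qed
  then have le: "packing_dim (UNIV :: 'a set) \<le> ennreal t" if "s < t" for t
    unfolding packing_dim_def using s that by (intro Inf_lower) auto
  show "packing_dim (UNIV :: 'a set) \<le> ennreal s"
  proof (rule ennreal_le_epsilon)
    fix e :: real assume "0 < e"
    then show "packing_dim (UNIV :: 'a set) \<le> ennreal s + ennreal e"
      using le[of "s + e"] s(1) by (simp add: ennreal_plus)
  qed
qed

section \<open>Atomic measures on nets\<close>

text \<open>Balls of radius \<open>r\<close> around points more than \<open>2 * r\<close> apart form a packing, so finiteness of the
  premeasure limits how many such points there are.\<close>

lemma packing_premeasure_finite_imp_card_bound:
  fixes E :: "'a::metric_space set"
  assumes "packing_premeasure s E < \<infinity>"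
  obtains \<delta> C where "0 < \<delta>"
    "\<And>r F. 0 < r \<Longrightarrow> r \<le> \<delta> \<Longrightarrow> finite F \<Longrightarrow> F \<subseteq> E \<Longrightarrow> pairwise (\<lambda>x y. 2 * r < dist x y) F \<Longrightarrow>
       real (card F) * (2 * r) powr s \<le> C"
proof -
  obtain \<delta> where \<delta>: "0 < \<delta>"
    "(SUP P\<in>packings \<delta> E. \<Sum>\<^sub>\<infinity>(x, r)\<in>P. ennreal ((2 * r) powr s)) < \<infinity>" (is "?S < _")
    using assms unfolding packing_premeasure_def by (auto simp: INF_less_iff)
  show ?thesis
  proof (rule that[OF \<delta>(1), of "enn2real ?S"])
    fix r :: real and F assume r: "0 < r" "r \<le> \<delta>"
      and F: "finite F" "F \<subseteq> E" "pairwise (\<lambda>x y. 2 * r < dist x y) F"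
    have "disjnt (cball x r) (cball y r)" if "x \<in> F" "y \<in> F" "x \<noteq> y" for x y
    proof -
      have "2 * r < dist x y" using F(3) that by (auto simp: pairwise_def)
      then have "\<not> (dist x z \<le> r \<and> dist y z \<le> r)" for z
        using dist_triangle2[of x y z] by linarith
      then show ?thesis by (simp add: disjnt_iff)
    qed
    then have "F \<times> {r} \<in> packings \<delta> E"
      using r F by (auto simp: packings_def pairwise_def countable_finite)
    then have "(\<Sum>\<^sub>\<infinity>(x, r)\<in>F \<times> {r}. ennreal ((2 * r) powr s)) \<le> ?S"
      by (rule SUP_upper)
    also have "(\<Sum>\<^sub>\<infinity>(x, r)\<in>F \<times> {r}. ennreal ((2 * r) powr s)) = (\<Sum>(x, r)\<in>F \<times> {r}. ennreal ((2 * r) powr s))"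
      using F by simp
    also have "\<dots> = ennreal (real (card F) * (2 * r) powr s)"
      by (simp add: sum.cartesian_product[symmetric] ennreal_mult' ennreal_of_nat_eq_real_of_nat)
    finally have "enn2real (ennreal (real (card F) * (2 * r) powr s)) \<le> enn2real ?S"
      using \<delta>(2) by (intro enn2real_mono) auto
    then show "real (card F) * (2 * r) powr s \<le> enn2real ?S" by simp
  qed
qed

text \<open>A separated set of maximal cardinality is a net, because a point far from all of it could
  be added.\<close>

lemma bounded_separated_imp_finite_net:
  fixes E :: "'a::metric_space set"
  assumes "0 \<le> \<rho>"
    and "\<And>F. finite F \<Longrightarrow> F \<subseteq> E \<Longrightarrow> pairwise (\<lambda>x y. \<rho> < dist x y) F \<Longrightarrow> card F \<le> N"
  obtains F where "finite F" "F \<subseteq> E" "pairwise (\<lambda>x y. \<rho> < dist x y) F"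
    "\<And>x. x \<in> E \<Longrightarrow> \<exists>y\<in>F. dist x y \<le> \<rho>"
proof -
  let ?P = "\<lambda>F. finite F \<and> F \<subseteq> E \<and> pairwise (\<lambda>x y. \<rho> < dist x y) F"
  have "\<exists>F. ?P F \<and> (\<forall>G. ?P G \<longrightarrow> card G \<le> card F)"
    by (rule ex_has_greatest_nat[where k = "{}" and b = "Suc N"]) (use assms in \<open>auto simp: less_Suc_eq_le\<close>)
  then obtain F where F: "?P F" and max: "\<And>G. ?P G \<Longrightarrow> card G \<le> card F"
    by blast
  show ?thesis
  proof (rule that)
    fix x assume x: "x \<in> E"
    show "\<exists>y\<in>F. dist x y \<le> \<rho>"
    proof (rule ccontr)
      assume "\<not> ?thesis"
      then have far: "\<And>y. y \<in> F \<Longrightarrow> \<rho> < dist x y" by force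
      then have "x \<notin> F" using assms(1) by fastforce
      moreover have "?P (insert x F)"
        using F x far by (auto simp: pairwise_insert dist_commute)
      ultimately show False using max[of "insert x F"] F by simp
    qed
  qed (use F in auto)
qed

text \<open>The measure is a sum over \<open>k\<close> of atoms of mass \<open>q k powr t\<close> on a \<open>q k\<close>-net of \<open>E\<close>, with
  \<open>q k = 2 * \<delta> / 2 ^ k\<close>. The gap \<open>s < t\<close> makes the total mass a convergent geometric series. It is
  kept as a function of point masses on the discrete \<open>\<sigma>\<close>-algebra, where countable sums are sums of
  functions; \<open>exists_finite_borel_dominating_point_measures\<close> passes to Borel sets.\<close>

lemma packing_premeasure_finite_imp_point_masses:
  fixes E :: "'a::metric_space set"
  assumes fin: "packing_premeasure s E < \<infinity>" and st: "s < t" and t: "0 \<le> t"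
  obtains f :: "'a \<Rightarrow> ennreal" and \<delta> where "emeasure (point_measure UNIV f) UNIV < \<infinity>" "0 < \<delta>"
    "\<And>x r. x \<in> E \<Longrightarrow> 0 < r \<Longrightarrow> r < \<delta> \<Longrightarrow> ennreal ((r / 2) powr t) \<le> emeasure (point_measure UNIV f) (cball x r)"
proof -
  obtain \<delta> C where \<delta>: "0 < \<delta>" and card: "\<And>r F. 0 < r \<Longrightarrow> r \<le> \<delta> \<Longrightarrow> finite F \<Longrightarrow> F \<subseteq> E \<Longrightarrow>
      pairwise (\<lambda>x y. 2 * r < dist x y) F \<Longrightarrow> real (card F) * (2 * r) powr s \<le> C"
    using packing_premeasure_finite_imp_card_bound[OF fin] by metis
  have C: "0 \<le> C" using card[of \<delta> "{}"] \<delta> by simp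
  define q where "q k = 2 * \<delta> * (1/2) ^ k" for k :: nat
  have q: "0 < q k" "q k \<le> 2 * \<delta>" for k
    using \<delta> by (auto simp: q_def power_le_one)
  have qcard: "real (card F) * q k powr s \<le> C"
    if "finite F" "F \<subseteq> E" "pairwise (\<lambda>x y. q k < dist x y) F" for k F
    using card[of "q k / 2" F] that q[of k] by simp
  have "\<exists>F. finite F \<and> F \<subseteq> E \<and> pairwise (\<lambda>x y. q k < dist x y) F \<and> (\<forall>x\<in>E. \<exists>y\<in>F. dist x y \<le> q k)" for k
  proof -
    have "card F \<le> nat \<lceil>C / q k powr s\<rceil>"
      if "finite F" "F \<subseteq> E" "pairwise (\<lambda>x y. q k < dist x y) F" for F
    proof -
      have "real (card F) \<le> C / q k powr s"
        using qcard[OF that] q(1)[of k] by (simp add: pos_le_divide_eq)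
      then show ?thesis by linarith
    qed
    then show ?thesis
      using bounded_separated_imp_finite_net[of "q k" E "nat \<lceil>C / q k powr s\<rceil>" ?thesis] q(1)[of k] by auto
  qed
  then obtain F where F: "\<And>k. finite (F k)" "\<And>k. F k \<subseteq> E" "\<And>k. pairwise (\<lambda>x y. q k < dist x y) (F k)"
    and net: "\<And>k x. x \<in> E \<Longrightarrow> \<exists>y\<in>F k. dist x y \<le> q k" by metis
  define f where "f x = (\<Sum>k. ennreal (q k powr t) * indicator (F k) x)" for x
  show ?thesis
  proof (rule that[of f "2 * \<delta>"])
    have "emeasure (point_measure UNIV f) UNIV = (\<integral>\<^sup>+x. f x \<partial>count_space UNIV)"
      by (simp add: point_measure_def emeasure_density)
    also have "\<dots> = (\<Sum>k. \<integral>\<^sup>+x. ennreal (q k powr t) * indicator (F k) x \<partial>count_space UNIV)"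
      unfolding f_def by (rule nn_integral_suminf) auto
    also have "\<dots> = (\<Sum>k. ennreal (q k powr t * real (card (F k))))"
      by (simp add: nn_integral_cmult F ennreal_mult' ennreal_of_nat_eq_real_of_nat)
    also have "\<dots> \<le> (\<Sum>k. ennreal (C * (2 * \<delta>) powr (t - s) * ((1/2) powr (t - s)) ^ k))"
    proof (intro suminf_le ennreal_leI)
      fix k
      have "q k powr t * real (card (F k)) = q k powr (t - s) * (real (card (F k)) * q k powr s)"
        by (simp add: powr_diff q(1))
      also have "\<dots> \<le> q k powr (t - s) * C"
        by (intro mult_left_mono qcard F) auto
      also have "q k powr (t - s) = (2 * \<delta>) powr (t - s) * ((1/2) powr (t - s)) ^ k"
        using \<delta> by (simp add: q_def powr_mult powr_power powr_realpow[symmetric] powr_powr mult.commute)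
      finally show "q k powr t * real (card (F k)) \<le> C * (2 * \<delta>) powr (t - s) * ((1/2) powr (t - s)) ^ k"
        by (simp add: mult_ac)
    qed auto
    also have "\<dots> < \<infinity>"
    proof -
      have "(1/2::real) powr (t - s) < 1"
        using st using powr_less_mono2[of "t - s" "1/2" 1] by simp
      then have "summable (\<lambda>k. C * (2 * \<delta>) powr (t - s) * ((1/2) powr (t - s)) ^ k)"
        by (intro summable_mult summable_geometric) auto
      then show ?thesis
        using C by (subst suminf_ennreal2) auto
    qed
    finally show "emeasure (point_measure UNIV f) UNIV < \<infinity>" .
  next
    fix x r assume x: "x \<in> E" and r: "0 < r" "r < 2 * \<delta>"
    have "\<exists>k. q k \<le> r"
    proof -
      obtain k where "(1/2) ^ k < r / (2 * \<delta>)"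
        using real_arch_pow_inv[of "r / (2 * \<delta>)" "1/2"] r \<delta> by auto
      then show ?thesis using \<delta> by (auto simp: q_def field_simps intro!: exI[of _ k])
    qed
    \<comment> \<open>The first scale not exceeding \<open>r\<close> is at least \<open>r / 2\<close>, because the scale before it exceeds \<open>r\<close>
      and scales are halved; \<open>r < 2 * \<delta> = q 0\<close> guarantees that there is a scale before it.\<close>
    define k where "k = (LEAST k. q k \<le> r)"
    have k: "q k \<le> r" unfolding k_def using \<open>\<exists>k. q k \<le> r\<close> by (rule LeastI_ex)
    have "k \<noteq> 0"
    proof
      assume "k = 0"
      then show False using k r by (simp add: q_def)
    qed
    then obtain j where j: "k = Suc j" by (cases k) auto
    then have "\<not> q j \<le> r" unfolding k_def by (metis lessI not_less_Least)
    then have rk: "r / 2 \<le> q k" by (simp add: j q_def)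
    obtain y where y: "y \<in> F k" "dist x y \<le> q k" using net[OF x] by blast
    have "ennreal ((r / 2) powr t) \<le> ennreal (q k powr t)"
      using rk r t by (intro ennreal_leI powr_mono2) auto
    also have "\<dots> = (\<Sum>i\<in>{k}. ennreal (q i powr t) * indicator (F i) y)"
      using y by simp
    also have "\<dots> \<le> f y"
      unfolding f_def by (rule sum_le_suminf) auto
    also have "f y = emeasure (point_measure UNIV f) {y}"
      by (subst emeasure_point_measure_finite2) auto
    also have "\<dots> \<le> emeasure (point_measure UNIV f) (cball x r)"
      using y k by (intro emeasure_mono) (auto simp: sets_point_measure)
    finally show "ennreal ((r / 2) powr t) \<le> emeasure (point_measure UNIV f) (cball x r)" .
  qed (use \<delta> in auto)
qed

section \<open>Countable superposition of atomic measures\<close>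

text \<open>Weighting the \<open>j\<close>-th measure by \<open>(1/2) ^ j\<close> divided by one more than its total mass
  makes the sum finite; the comparison constants are these weights. Lower bounds on the mass of balls
  survive such a comparison, which is why domination up to a constant suffices below.\<close>

lemma exists_finite_borel_dominating_point_measures:
  fixes g :: "nat \<Rightarrow> 'a::topological_space \<Rightarrow> ennreal"
  assumes fin: "\<And>j. emeasure (point_measure UNIV (g j)) UNIV < \<infinity>"
  obtains M :: "'a measure" where "sets M = sets borel" "finite_measure M"
    "\<And>j. \<exists>c>0. \<forall>A\<in>sets borel. ennreal c * emeasure (point_measure UNIV (g j)) A \<le> emeasure M A"
proof -
  define m where "m j = enn2real (emeasure (point_measure UNIV (g j)) UNIV)" for j
  have m: "0 \<le> m j" "emeasure (point_measure UNIV (g j)) UNIV = ennreal (m j)" for j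
    using fin[of j] by (auto simp: m_def)
  define c where "c j = (1/2) ^ j / (1 + m j)" for j
  have c: "0 < c j" "c j * m j \<le> (1/2) ^ j" for j
    using m(1)[of j] by (auto simp: c_def field_simps add_pos_nonneg)
  define f where "f x = (\<Sum>j. ennreal (c j) * g j x)" for x
  have "emeasure (point_measure UNIV f) UNIV = (\<integral>\<^sup>+x. f x \<partial>count_space UNIV)"
    by (simp add: point_measure_def emeasure_density)
  also have "\<dots> = (\<Sum>j. \<integral>\<^sup>+x. ennreal (c j) * g j x \<partial>count_space UNIV)"
    unfolding f_def by (rule nn_integral_suminf) auto
  also have "\<dots> = (\<Sum>j. ennreal (c j) * emeasure (point_measure UNIV (g j)) UNIV)"
    by (simp add: nn_integral_cmult point_measure_def emeasure_density)
  also have "\<dots> \<le> (\<Sum>j. ennreal ((1/2) ^ j))"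
    using c m(1) by (intro suminf_le) (auto simp: m(2) less_imp_le simp flip: ennreal_mult intro: ennreal_leI)
  also have "\<dots> < \<infinity>"
    by (subst suminf_ennreal2) (auto intro: summable_geometric)
  finally have total: "emeasure (point_measure UNIV f) UNIV < \<infinity>" .
  define M where "M = distr (point_measure UNIV f) borel (\<lambda>x. x)"
  have em: "emeasure M A = emeasure (point_measure UNIV f) A" if "A \<in> sets borel" for A
    using that unfolding M_def by (subst emeasure_distr) (auto simp: measurable_def sets_point_measure space_point_measure)
  show ?thesis
  proof (rule that[of M])
    show "sets M = sets borel" by (simp add: M_def)
    show "finite_measure M"
      using total em[of UNIV] by (intro finite_measureI) (auto simp: M_def)
    fix j
    have le: "ennreal (c j) * g j x \<le> f x" for x
      using sum_le_suminf[of "\<lambda>j. ennreal (c j) * g j x" "{j}"] by (simp add: f_def)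
    have "ennreal (c j) * emeasure (point_measure UNIV (g j)) A \<le> emeasure (point_measure UNIV f) A" for A
    proof -
      have "ennreal (c j) * emeasure (point_measure UNIV (g j)) A
          = (\<integral>\<^sup>+x. ennreal (c j) * (g j x * indicator A x) \<partial>count_space UNIV)"
        by (simp add: nn_integral_cmult point_measure_def emeasure_density)
      also have "\<dots> \<le> (\<integral>\<^sup>+x. f x * indicator A x \<partial>count_space UNIV)"
        using le by (intro nn_integral_mono) (auto simp: indicator_def)
      finally show ?thesis by (simp add: point_measure_def emeasure_density)
    qed
    then show "\<exists>c>0. \<forall>A\<in>sets borel. ennreal c * emeasure (point_measure UNIV (g j)) A \<le> emeasure M A"
      using c(1) em by (intro exI[of _ "c j"]) auto
  qed
qed

section \<open>Existence of an optimal measure\<close>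

lemma lower_density_posI:
  assumes "0 < \<delta>" "0 < c"
    and "\<And>r. 0 < r \<Longrightarrow> r < \<delta> \<Longrightarrow> ennreal (c * (2 * r) powr t) \<le> emeasure M (cball x r)"
  shows "0 < lower_density t M x"
proof -
  have "ennreal c \<le> lower_density t M x"
    unfolding lower_density_def
  proof (rule Liminf_bounded, rule eventually_at_rightI[of 0 \<delta>])
    fix r assume "r \<in> {0<..<\<delta>}"
    then have r: "0 < r" "r < \<delta>" by auto
    then have p: "0 < (2 * r) powr t" by simp
    have "ennreal c = ennreal (c * (2 * r) powr t) / ennreal ((2 * r) powr t)"
      using p assms(2) by (simp add: divide_ennreal)
    also have "\<dots> \<le> emeasure M (cball x r) / ennreal ((2 * r) powr t)"
      using assms(3) r by (intro divide_right_mono_ennreal) auto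
    finally show "ennreal c \<le> emeasure M (cball x r) / ennreal ((2 * r) powr t)" .
  qed (use assms in auto)
  moreover have "0 < ennreal c" using assms by simp
  ultimately show ?thesis by (rule order.strict_trans2[rotated])
qed

text \<open>Positive density at every point, for any one exponent, yields full support.\<close>

lemma lower_density_pos_imp_emeasure_pos:
  assumes "sets M = sets borel" "0 < lower_density s M x" "open U" "x \<in> U"
  shows "0 < emeasure M U"
proof -
  obtain n where n: "\<And>r. 0 < r \<Longrightarrow> r \<le> inverse (real (Suc n)) \<Longrightarrow>
      ennreal (inverse (real (Suc n)) * (2 * r) powr s) \<le> emeasure M (cball x r)"
    using lower_density_pos_imp_mass_bound[OF assms(2)] by metis
  obtain e where e: "0 < e" "cball x e \<subseteq> U"
    using assms(3,4) open_contains_cball by blast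
  define r where "r = min e (inverse (real (Suc n)))"
  have r: "0 < r" "r \<le> inverse (real (Suc n))" "r \<le> e" using e by (auto simp: r_def)
  have "0 < ennreal (inverse (real (Suc n)) * (2 * r) powr s)" using r by simp
  also have "\<dots> \<le> emeasure M (cball x r)" using n r by blast
  also have "\<dots> \<le> emeasure M U"
    using e r assms by (intro emeasure_mono) (auto intro: order_trans)
  finally show ?thesis .
qed

text \<open>Superpose the counting measures of finite \<open>1 / (n + 1)\<close>-nets of the space.\<close>

lemma compact_imp_fully_supported_finite_borel:
  assumes "compact (UNIV :: 'a::metric_space set)"
  obtains M :: "'a::metric_space measure" where "fully_supported_finite_borel M"
proof -
  have "\<exists>K. finite K \<and> (UNIV :: 'a set) \<subseteq> (\<Union>x\<in>K. ball x (inverse (real (Suc n))))" for n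
    using seq_compact_imp_totally_bounded[of "UNIV :: 'a set"] assms
    by (metis compact_eq_seq_compact_metric inverse_positive_iff_positive of_nat_0_less_iff zero_less_Suc)
  then obtain K where K: "\<And>n. finite (K n)" "\<And>n. (UNIV :: 'a set) \<subseteq> (\<Union>x\<in>K n. ball x (inverse (real (Suc n))))"
    by metis
  have "emeasure (point_measure UNIV (indicator (K n) :: 'a \<Rightarrow> ennreal)) UNIV < \<infinity>" for n
    by (simp add: point_measure_def emeasure_density K ennreal_of_nat_eq_real_of_nat)
  then obtain M :: "'a measure" where M: "sets M = sets borel" "finite_measure M"
    and dom: "\<And>n. \<exists>c>0. \<forall>A\<in>sets borel. ennreal c * emeasure (point_measure UNIV (indicator (K n))) A \<le> emeasure M A"
    using exists_finite_borel_dominating_point_measures[of "\<lambda>n. indicator (K n)"] by metis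
  have "0 < emeasure M U" if U: "open U" "x \<in> U" for U x
  proof -
    obtain e where e: "0 < e" "ball x e \<subseteq> U" using U open_contains_ball by blast
    obtain n where n: "inverse (real (Suc n)) < e" using reals_Archimedean e by blast
    obtain y where y: "y \<in> K n" "dist x y < inverse (real (Suc n))"
      using K(2)[of n] by (fastforce simp: dist_commute)
    then have yU: "y \<in> U" using e n by auto
    obtain c where c: "0 < c" "ennreal c * emeasure (point_measure UNIV (indicator (K n))) U \<le> emeasure M U"
      using dom[of n] U by (metis borel_open)
    \<comment> \<open>The open set contains a net point, and that point alone carries positive mass.\<close>
    have "emeasure (point_measure UNIV (indicator (K n))) {y} = (1::ennreal)"
      using y by (subst emeasure_point_measure_finite2) auto
    moreover have "emeasure (point_measure UNIV (indicator (K n))) {y} \<le> emeasure (point_measure UNIV (indicator (K n))) U"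
      using yU by (intro emeasure_mono) (auto simp: sets_point_measure)
    ultimately have "0 < ennreal c * emeasure (point_measure UNIV (indicator (K n))) U"
      using c(1) by (auto simp: ennreal_zero_less_mult_iff intro: order.strict_trans2[of 0 1])
    then show ?thesis using c(2) by (rule order.strict_trans2)
  qed
  then show ?thesis
    using M that unfolding fully_supported_finite_borel_def measure_support_def by blast
qed

text \<open>One measure has to serve all exponents above the packing dimension at once. Countably many
  exponents \<open>t n\<close>, and countably many pieces \<open>E n i\<close> for each of them, suffice, so a single
  superposition over all pairs \<open>(n, i)\<close> works.\<close>

lemma exists_density_dim_le_packing_dim:
  assumes "packing_dim (UNIV :: 'a::metric_space set) < \<infinity>"
  obtains M :: "'a::metric_space measure" where "fully_supported_finite_borel M"
    "density_dim M \<le> packing_dim (UNIV :: 'a set)"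
proof -
  let ?X = "UNIV :: 'a set"
  define e where "e n = inverse (real (Suc n))" for n
  have e: "0 < e n" for n by (simp add: e_def)
  obtain d where d: "packing_dim ?X = ennreal d" "0 \<le> d"
    using assms by (cases "packing_dim ?X") auto
  have "\<exists>s\<ge>0. s < d + e n \<and> packing_measure s ?X = 0" for n
  proof -
    have "packing_dim ?X < ennreal (d + e n)"
      unfolding d(1) using d(2) e[of n] by (simp add: ennreal_lessI)
    then show ?thesis
      unfolding packing_dim_def Inf_less_iff using ennreal_less_iff by auto
  qed
  then obtain s where s: "\<And>n. 0 \<le> s n" "\<And>n. s n < d + e n" "\<And>n. packing_measure (s n) ?X = 0"
    by metis
  have "\<exists>E :: nat \<Rightarrow> 'a set. ?X \<subseteq> (\<Union>i. E i) \<and> (\<forall>i. packing_premeasure (s n) (E i) < \<infinity>)" for n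
  proof -
    have "packing_measure (s n) ?X < 1" by (simp add: s)
    then obtain E :: "nat \<Rightarrow> 'a set" where E: "?X \<subseteq> (\<Union>i. E i)" "(\<Sum>i. packing_premeasure (s n) (E i)) < 1"
      unfolding packing_measure_def INF_less_iff by auto
    \<comment> \<open>A countable sum below \<open>1\<close> forces each term to be finite.\<close>
    have "packing_premeasure (s n) (E i) < \<infinity>" for i
    proof -
      have "packing_premeasure (s n) (E i) \<le> (\<Sum>i. packing_premeasure (s n) (E i))"
        using sum_le_suminf[of "\<lambda>i. packing_premeasure (s n) (E i)" "{i}"] by simp
      also have "\<dots> < \<infinity>" using E(2) by (rule order.strict_trans) simp
      finally show ?thesis .
    qed
    then show ?thesis using E by blast
  qed
  then obtain E :: "nat \<Rightarrow> nat \<Rightarrow> 'a set"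
    where E: "\<And>n. ?X \<subseteq> (\<Union>i. E n i)" "\<And>n i. packing_premeasure (s n) (E n i) < \<infinity>"
    by metis
  \<comment> \<open>The atomic measures need an exponent strictly above \<open>s n\<close>; \<open>t n\<close> still lies below \<open>d + 2 * e n\<close>.\<close>
  define t where "t n = s n + e n" for n
  have t: "s n < t n" "0 \<le> t n" for n using s(1)[of n] e[of n] by (auto simp: t_def)
  have "\<exists>f \<delta>. emeasure (point_measure ?X f) UNIV < \<infinity> \<and> 0 < \<delta> \<and>
      (\<forall>x\<in>E n i. \<forall>r. 0 < r \<longrightarrow> r < \<delta> \<longrightarrow>
        ennreal ((r / 2) powr t n) \<le> emeasure (point_measure UNIV f) (cball x r))" for n i
    using packing_premeasure_finite_imp_point_masses[OF E(2) t, of n i] by metis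
  then obtain f \<delta> where f: "\<And>n i. emeasure (point_measure ?X (f n i)) UNIV < \<infinity>"
      "\<And>n i. 0 < \<delta> n i" "\<And>n i x r. x \<in> E n i \<Longrightarrow> 0 < r \<Longrightarrow> r < \<delta> n i \<Longrightarrow>
        ennreal ((r / 2) powr t n) \<le> emeasure (point_measure UNIV (f n i)) (cball x r)"
    by metis
  obtain M :: "'a measure" where M: "sets M = sets borel" "finite_measure M"
    and dom: "\<And>j. \<exists>c>0. \<forall>A\<in>sets borel. ennreal c *
        emeasure (point_measure UNIV (case prod_decode j of (n, i) \<Rightarrow> f n i)) A \<le> emeasure M A"
    using exists_finite_borel_dominating_point_measures[of "\<lambda>j. case prod_decode j of (n, i) \<Rightarrow> f n i"] f(1)
    by (metis (mono_tags, lifting) case_prod_unfold)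
  have pos: "0 < lower_density (t n) M x" for n x
  proof -
    obtain i where i: "x \<in> E n i" using E(1)[of n] by blast
    obtain c where c: "0 < c"
      "\<And>A. A \<in> sets borel \<Longrightarrow> ennreal c * emeasure (point_measure UNIV (f n i)) A \<le> emeasure M A"
      using dom[of "prod_encode (n, i)"] by auto
    show ?thesis
    \<comment> \<open>The factor \<open>(1/4) powr t n\<close> turns \<open>2 * r\<close> of the density into \<open>r / 2\<close> of the mass bound.\<close>
    proof (rule lower_density_posI[of "\<delta> n i" "c * (1/4) powr t n"])
      fix r assume r: "0 < r" "r < \<delta> n i"
      have "(1/4) powr t n * (2 * r) powr t n = (r / 2) powr t n"
        using r by (subst powr_mult[symmetric]) auto
      then have "ennreal (c * (1/4) powr t n * (2 * r) powr t n) = ennreal c * ennreal ((r / 2) powr t n)"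
        using c(1) by (simp add: mult.assoc ennreal_mult)
      also have "\<dots> \<le> ennreal c * emeasure (point_measure UNIV (f n i)) (cball x r)"
        using f(3)[OF i r] by (intro mult_left_mono) auto
      also have "\<dots> \<le> emeasure M (cball x r)" by (rule c) simp
      finally show "ennreal (c * (1/4) powr t n * (2 * r) powr t n) \<le> emeasure M (cball x r)" .
    qed (use f(2) c in auto)
  qed
  show ?thesis
  proof (rule that[of M])
    show "fully_supported_finite_borel M"
      using M lower_density_pos_imp_emeasure_pos[OF M(1) pos]
      unfolding fully_supported_finite_borel_def measure_support_def by blast
    show "density_dim M \<le> packing_dim ?X"
    proof (rule ennreal_le_epsilon)
      fix \<epsilon> :: real assume "0 < \<epsilon>"
      then obtain n where n: "e n < \<epsilon> / 2" unfolding e_def using reals_Archimedean[of "\<epsilon> / 2"] by auto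
      have "density_dim M \<le> ennreal (t n)"
        unfolding density_dim_def using pos t(2) by (intro Inf_lower) auto
      also have "\<dots> \<le> ennreal (d + \<epsilon>)"
        using s(2)[of n] n by (intro ennreal_leI) (simp add: t_def)
      also have "\<dots> = packing_dim ?X + ennreal \<epsilon>"
        using d \<open>0 < \<epsilon>\<close> by simp
      finally show "density_dim M \<le> packing_dim ?X + ennreal \<epsilon>" .
    qed
  qed
qed

theorem theorem3p5:
  assumes "compact (UNIV :: 'a::metric_space set)"
    and "doubling (UNIV :: 'a set)"
  shows "(\<exists>M :: 'a measure. fully_supported_finite_borel M \<and>
            packing_dim (UNIV :: 'a set) = density_dim M) \<and>
         (\<forall>M :: 'a measure. fully_supported_finite_borel M \<longrightarrow>
            packing_dim (UNIV :: 'a set) \<le> density_dim M)"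
proof -
  have lower: "packing_dim (UNIV :: 'a set) \<le> density_dim M"
    if "fully_supported_finite_borel M" for M :: "'a measure"
    using that packing_dim_le_density_dim unfolding fully_supported_finite_borel_def by blast
  obtain M :: "'a measure" where M: "fully_supported_finite_borel M"
    "density_dim M \<le> packing_dim (UNIV :: 'a set)"
  proof (cases "packing_dim (UNIV :: 'a set) < \<infinity>")
    case True
    then show ?thesis using exists_density_dim_le_packing_dim that by blast
  next
    case False
    then have "packing_dim (UNIV :: 'a set) = \<infinity>" by (metis infinity_ennreal_def top.not_eq_extremum)
    moreover obtain M :: "'a measure" where "fully_supported_finite_borel M"
      using compact_imp_fully_supported_finite_borel[OF assms(1)] by blast
    ultimately show ?thesis using that[of M] by simp
  qed
  show ?thesis using M lower by (blast intro: order_antisym)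
qed

end
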